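(* No Nevanlinna--Odeh multiplier exists for the six-step BDF method; that is, there is no $6$-tuple $(\mu_1,\dots,\mu_6)$ of real numbers that is a Nevanlinna--Odeh multiplier for the six-step BDF method.
   Context: The generating polynomial of the six-step BDF (backward difference formula) method is $$\alpha(\zeta)=\sum_{j=1}^6\frac1j\,\zeta^{6-j}(\zeta-1)^j=\sum_{j=0}^6\alpha_j\zeta^j .$$ A $6$-tuple $(\mu_1,\dots,\mu_6)$ of real numbers is called a Nevanlinna--Odeh multiplier for the six-step BDF method if, with $\mu(\zeta):=\zeta^6-\mu_1\zeta^5-\mu_2\zeta^4-\cdots-\mu_6$, all of the following hold: (i) (A-stability condition) $\operatorname{Re}\dfrac{\alpha(\zeta)}{\mu(\zeta)}>0$ for all $\zeta\in\mathbb{C}$ with $|\zeta|>1$; (ii) the polynomials $\alpha$ and $\mu$ have no common (nonconstant) divisor; (iii) $1-|\mu_1|-|\mu_2|-\cdots-|\mu_6|>0$. *)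

theory Defs
  imports Complex_Main "HOL-Computational_Algebra.Polynomial"
begin

definition bdf6_poly :: "real poly" where
  "bdf6_poly = (\<Sum>j=1..6. smult (1 / real j) (monom 1 (6 - j) * [:-1, 1:] ^ j))"

(* A 6-tuple is given by the values m 1, ..., m 6; other values of m are never used. *)
definition multiplier_poly :: "(nat \<Rightarrow> real) \<Rightarrow> real poly" where
  "multiplier_poly m = monom 1 6 - (\<Sum>j=1..6. monom (m j) (6 - j))"

(* Since x / 0 = 0, the first condition also requires that the multiplier polynomial has no
   zero outside the closed unit disc; the third condition implies this anyway. *)
definition nevanlinna_odeh_multiplier_bdf6 :: "(nat \<Rightarrow> real) \<Rightarrow> bool" where
  "nevanlinna_odeh_multiplier_bdf6 m \<longleftrightarrow>
     (\<forall>z::complex. norm z > 1 \<longrightarrow>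
        Re (poly (map_poly complex_of_real bdf6_poly) z /
            poly (map_poly complex_of_real (multiplier_poly m)) z) > 0) \<and>
     coprime bdf6_poly (multiplier_poly m) \<and>
     1 - (\<Sum>j=1..6. \<bar>m j\<bar>) > 0"

end

theory Submission imports Defs begin

text \<open>
  The A-stability condition extends by continuity to those points of the unit circle at which the
  multiplier polynomial does not vanish, where it becomes
  \<open>Re (\<alpha>(z) / \<mu>(z)) \<ge> 0\<close>. This already fails at the single point \<open>z = \<i>\<close>. Indeed
  \<open>15 \<alpha>(\<i>) = 22 - 8 \<i>\<close>, so that
  \<open>15 Re (\<alpha>(\<i>) * cnj (\<mu>(\<i>))) = -22 (1 + m 2 - m 4 + m 6) + 8 (m 1 - m 3 + m 5)\<close>.
  Each \<open>m j\<close> occurs here with a coefficient of modulus at most 22, so the right-hand side is at most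
  \<open>-22 (1 - (\<Sum>j=1..6. \<bar>m j\<bar>))\<close>, which is negative by the third condition on a multiplier.
  What makes \<open>\<i>\<close> work is that \<open>\<alpha>(\<i>) / \<i>^6 = (-22 + 8 \<i>) / 15\<close> has a negative real part, which
  dominates the imaginary part: multiplication by the powers \<open>\<i>^j\<close>, which produces the coefficients
  of the \<open>m j\<close>, only permutes these two parts up to sign.
\<close>

lemma Re_divide_nonneg_on_unit_circle:
  fixes f g :: "complex \<Rightarrow> complex"
  assumes pos: "\<And>z. norm z > 1 \<Longrightarrow> Re (f z / g z) > 0"
    and w: "norm w = 1" and cont: "isCont f w" "isCont g w" and nz: "g w \<noteq> 0"
  shows "Re (f w / g w) \<ge> 0"
proof -
  define z where "z = (\<lambda>n. of_real (1 + 1 / real (Suc n)) * w)"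
  have "(\<lambda>n. of_real (1 + 1 / real (Suc n)) * w) \<longlonglongrightarrow> of_real (1 + 0) * w"
    by (intro tendsto_intros lim_1_over_n LIMSEQ_Suc[OF lim_1_over_n])
  then have "z \<longlonglongrightarrow> w"
    by (simp only: z_def add_0_right of_real_1 mult_1)
  then have "(\<lambda>n. f (z n)) \<longlonglongrightarrow> f w" "(\<lambda>n. g (z n)) \<longlonglongrightarrow> g w"
    using cont by (auto intro: isCont_tendsto_compose)
  then have "(\<lambda>n. Re (f (z n) / g (z n))) \<longlonglongrightarrow> Re (f w / g w)"
    using nz by (intro tendsto_Re tendsto_divide)
  moreover have "norm (z n) > 1" for n
    unfolding z_def norm_mult w norm_of_real by simp
  then have "Re (f (z n) / g (z n)) \<ge> 0" for n
    using pos less_imp_le by blast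
  ultimately show ?thesis
    by (intro LIMSEQ_le_const) auto
qed

lemma bdf6_poly_at_ii:
  "poly (map_poly complex_of_real bdf6_poly) \<i> = Complex (22 / 15) (- 8 / 15)"
proof -
  have eq: "bdf6_poly = [:1/6, -6/5, 15/4, -20/3, 15/2, -6, 49/20:]"
    by (simp add: bdf6_poly_def numeral_eq_Suc monom_altdef)
  show ?thesis
    unfolding eq by (simp add: map_poly_pCons complex_eq_iff)
qed

lemma multiplier_poly_at_ii:
  "poly (map_poly complex_of_real (multiplier_poly m)) \<i> =
     Complex (- (1 + m 2 - m 4 + m 6)) (- (m 1 - m 3 + m 5))"
proof -
  have eq: "multiplier_poly m = [:- m 6, - m 5, - m 4, - m 3, - m 2, - m 1, 1:]"
    by (simp add: multiplier_poly_def numeral_eq_Suc monom_altdef)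
  show ?thesis
    unfolding eq by (simp add: map_poly_pCons complex_eq_iff)
qed

theorem mainTheorem3:
  shows "\<not> (\<exists>m :: nat \<Rightarrow> real. nevanlinna_odeh_multiplier_bdf6 m)"
proof
  assume "\<exists>m :: nat \<Rightarrow> real. nevanlinna_odeh_multiplier_bdf6 m"
  then obtain m :: "nat \<Rightarrow> real" where m: "nevanlinna_odeh_multiplier_bdf6 m" ..
  define \<alpha> where "\<alpha> = poly (map_poly complex_of_real bdf6_poly)"
  define \<mu> where "\<mu> = poly (map_poly complex_of_real (multiplier_poly m))"
  define u where "u = 1 + m 2 - m 4 + m 6"
  define v where "v = m 1 - m 3 + m 5"
  have \<alpha>: "\<alpha> \<i> = Complex (22 / 15) (- 8 / 15)" and \<mu>: "\<mu> \<i> = Complex (- u) (- v)"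
    by (simp_all add: \<alpha>_def \<mu>_def u_def v_def bdf6_poly_at_ii multiplier_poly_at_ii)
  define a where "a = \<bar>m 1\<bar> + \<bar>m 3\<bar> + \<bar>m 5\<bar>"
  define b where "b = \<bar>m 2\<bar> + \<bar>m 4\<bar> + \<bar>m 6\<bar>"
  have "{1..6} = {1, 2, 3, 4, 5, 6::nat}"
    by auto
  then have "a + b < 1"
    using m by (simp add: nevanlinna_odeh_multiplier_bdf6_def a_def b_def)
  moreover have "0 \<le> a" "0 \<le> b"
    by (simp_all add: a_def b_def)
  moreover have "v \<le> a" "1 - b \<le> u"
    unfolding u_def v_def a_def b_def by linarith+
  ultimately have "u > 0" and neg: "8 * v < 22 * u"
    by linarith+
  have "Re (\<alpha> \<i> / \<mu> \<i>) \<ge> 0"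
  proof (rule Re_divide_nonneg_on_unit_circle[where f = \<alpha> and g = \<mu>])
    show "Re (\<alpha> z / \<mu> z) > 0" if "norm z > 1" for z
      using m that by (simp add: nevanlinna_odeh_multiplier_bdf6_def \<alpha>_def \<mu>_def)
    show "\<mu> \<i> \<noteq> 0"
      using \<open>u > 0\<close> by (simp add: \<mu> complex_eq_iff)
  qed (simp_all add: \<alpha>_def \<mu>_def)
  moreover have "Re (\<alpha> \<i> / \<mu> \<i>) = (8 * v / 15 - 22 * u / 15) / (u\<^sup>2 + v\<^sup>2)"
    by (simp add: \<alpha> \<mu> Re_divide)
  moreover have "u\<^sup>2 + v\<^sup>2 > 0"
    using \<open>u > 0\<close> by (simp add: sum_power2_gt_zero_iff)
  then have "(8 * v / 15 - 22 * u / 15) / (u\<^sup>2 + v\<^sup>2) < 0"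
    using neg by (intro divide_neg_pos) auto
  ultimately show False
    by linarith
qed

end
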